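(* Let $\beta\in(0,d]$ and $\alpha\in(0,d)$ with $\frac{d-\beta}{2}<\alpha<d-\frac{\beta}{2}$. Then for every $r<\frac{2d}{2\alpha+\beta}$ there exists a sequence of functions $\Phi_N\in M_b(\mathbb{R}^d)\cap\dot{B}^{\beta-d}_{\infty,\infty}(\mathbb{R}^d)$ such that $\|\Phi_N\|_{M_b}\le C$ and $\|\Phi_N\|_{\dot{B}^{\beta-d}_{\infty,\infty}}\le C$ for a constant $C$ independent of $N$, and $$\|\widehat{I_\alpha\Phi_N}\|_{L^{r,\infty}}\to\infty\quad\text{as }N\to\infty.$$
   Context: $p_t(x)=(4\pi t)^{-d/2}e^{-|x|^2/(4t)}$. $\|f\|_{\dot{B}^{\beta-d}_{\infty,\infty}}:=\sup_{t>0}t^{\frac{d-\beta}{2}}\|p_t*f\|_{L^\infty}$ and $\dot{B}^{\beta-d}_{\infty,\infty}$ is the set of tempered distributions for which it is finite. $M_b(\mathbb{R}^d)$ is the space of finite Radon measures with norm the total variation (for functions, the $L^1$ norm). The Fourier transform is $\widehat{f}(\xi)=\int e^{-2\pi i x\cdot\xi}f(x)\,dx$, and $I_\alpha$ is the Riesz potential of order $\alpha$, so $\widehat{I_\alpha f}(\xi)=(2\pi|\xi|)^{-\alpha}\widehat{f}(\xi)$. $\|g\|_{L^{r,\infty}}=\sup_{t>0}t\,|\{x:|g(x)|>t\}|^{1/r}$. *)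

theory Defs
  imports "HOL-Analysis.Analysis"
begin

definition heat_kernel :: "real \<Rightarrow> 'a::euclidean_space \<Rightarrow> real" where
  "heat_kernel t x = (4 * pi * t) powr (- real DIM('a) / 2) * exp (- (norm x)\<^sup>2 / (4 * t))"

definition heat_conv :: "real \<Rightarrow> ('a::euclidean_space \<Rightarrow> real) \<Rightarrow> 'a \<Rightarrow> real" where
  "heat_conv t f x = (\<integral>y. heat_kernel t (x - y) * f y \<partial>lborel)"

definition fourier :: "('a::euclidean_space \<Rightarrow> real) \<Rightarrow> 'a \<Rightarrow> complex" where
  "fourier f \<xi> = (\<integral>x. cis (- 2 * pi * (x \<bullet> \<xi>)) * complex_of_real (f x) \<partial>lborel)"

definition fourier_riesz :: "real \<Rightarrow> ('a::euclidean_space \<Rightarrow> real) \<Rightarrow> 'a \<Rightarrow> complex" where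
  "fourier_riesz \<alpha> f \<xi> = complex_of_real ((2 * pi * norm \<xi>) powr (- \<alpha>)) * fourier f \<xi>"

definition weak_Lr_norm :: "real \<Rightarrow> ('a::euclidean_space \<Rightarrow> 'b::real_normed_vector) \<Rightarrow> ennreal" where
  "weak_Lr_norm r g = (SUP t\<in>{0<..}.
      (if emeasure lborel {x. t < norm (g x)} = \<infinity> then \<infinity>
       else ennreal (t * measure lborel {x. t < norm (g x)} powr (1 / r))))"

end

theory Submission
  imports Defs "HOL-Probability.Characteristic_Functions" "HOL-Real_Asymp.Real_Asymp"
begin

text \<open>
  The functions are modulated Gaussian chirps, at a scale K tending to infinity: the real or the
  imaginary part of
  G(x) = A exp(-pi a |x|^2 + i pi b |x|^2 + 2 pi i v.x) with a = K^(2 - 2 beta/d),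
  b = K^(2 - beta/d), A = a^(d/2) and |v| = K^(1 + eps).
  The envelope has mass 1, while the chirp spreads the Fourier transform evenly over the ball of
  radius K about v, where its modulus is of order K^(-beta/2); hence the weak norm of the transform
  of the Riesz potential is at least of order K^(d/r - beta/2 - alpha (1 + eps)), a positive power
  for small eps. For heat times t up to K^(-2), the bound |G| \<le> A = K^(d - beta) suffices. For larger t
  the heat flow sees a function whose frequencies have size K^(1 + eps), up to Gaussian tails
  of width K, and gains a factor exp(-K^(2 eps)) that beats every power of K.
\<close>

section \<open>Gaussian integrals with a linear phase\<close>

lemma borel_measurable_cis [measurable (raw)]:
  "f \<in> borel_measurable M \<Longrightarrow> (\<lambda>x. cis (f x)) \<in> borel_measurable M"
  by (rule borel_measurable_continuous_on[of cis]) (intro continuous_intros)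

text \<open>The rescaling by sqrt (2 p) turns the integrand into a multiple of the standard normal
  density times a character, so the value is read off from the characteristic function of the
  standard normal distribution at w / sqrt (2 p).\<close>

lemma has_bochner_integral_gauss_real:
  fixes p w :: real
  assumes "p > 0"
  shows "has_bochner_integral lborel (\<lambda>y. complex_of_real (exp (- p * y\<^sup>2)) * cis (w * y))
           (complex_of_real (sqrt (pi / p) * exp (- w\<^sup>2 / (4 * p))))"
proof -
  define t where "t = w / sqrt (2 * p)"
  define g where "g = (\<lambda>y::real. complex_of_real (exp (- y\<^sup>2 / 2)) * cis (t * y))"
  have std: "integrable lborel std_normal_density" by simp
  have g_alt: "g y = complex_of_real (sqrt (2 * pi)) * (std_normal_density y *\<^sub>R cis (t * y))" for y
    by (simp add: g_def std_normal_density_def scaleR_conv_of_real)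
  have int: "integrable lborel (\<lambda>y. std_normal_density y *\<^sub>R cis (t * y))"
    by (rule Bochner_Integration.integrable_bound[OF std]) auto
  have "complex_of_real (exp (- (t^2) / 2)) = char std_normal_distribution t"
    by (simp add: char_std_normal_distribution)
  also have "\<dots> = (\<integral>y. std_normal_density y *\<^sub>R cis (t * y) \<partial>lborel)"
    unfolding char_def by (subst integral_density) (auto simp: cis_conv_exp mult.commute)
  finally have "(\<integral>y. g y \<partial>lborel) = complex_of_real (sqrt (2 * pi) * exp (- (t^2) / 2))"
    unfolding g_alt integral_mult_right_zero by simp
  moreover have "integrable lborel g"
    unfolding g_alt[abs_def] using int by (rule integrable_mult_right)
  ultimately have "has_bochner_integral lborel g (complex_of_real (sqrt (2 * pi) * exp (- (t^2) / 2)))"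
    by (simp add: has_bochner_integral_iff)
  then have "has_bochner_integral lborel (\<lambda>y. g (0 + sqrt (2 * p) * y))
      (complex_of_real (sqrt (2 * pi) * exp (- (t^2) / 2)) /\<^sub>R \<bar>sqrt (2 * p)\<bar>)"
    using assms by (subst (asm) lborel_has_bochner_integral_real_affine_iff[where c="sqrt (2 * p)" and t=0]) auto
  also have "(\<lambda>y. g (0 + sqrt (2 * p) * y)) = (\<lambda>y. complex_of_real (exp (- p * y\<^sup>2)) * cis (w * y))"
    using assms by (auto simp: g_def t_def power_mult_distrib fun_eq_iff)
  also have "complex_of_real (sqrt (2 * pi) * exp (- (t^2) / 2)) /\<^sub>R \<bar>sqrt (2 * p)\<bar>
      = complex_of_real (sqrt (pi / p) * exp (- w\<^sup>2 / (4 * p)))"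
  proof -
    have "sqrt (2 * pi) * exp (- (t^2) / 2) / sqrt (2 * p) = sqrt (pi / p) * exp (- w\<^sup>2 / (4 * p))"
      using assms by (simp add: t_def power_divide power_mult_distrib real_sqrt_divide real_sqrt_mult)
    moreover have "complex_of_real X /\<^sub>R \<bar>sqrt (2 * p)\<bar> = complex_of_real (X / sqrt (2 * p))" for X
      using assms by (simp add: scaleR_conv_of_real divide_inverse mult.commute)
    ultimately show ?thesis by metis
  qed
  finally show ?thesis .
qed

text \<open>\<open>lborel\<close> is the image of the product of one-dimensional Lebesgue measures
  over \<open>Basis\<close> under the map from coordinates to vectors, so Fubini for finite products
  applies.\<close>

lemma has_bochner_integral_lborel_prod:
  fixes f :: "'a::euclidean_space \<Rightarrow> real \<Rightarrow> complex"
  assumes "\<And>b. b \<in> Basis \<Longrightarrow> has_bochner_integral lborel (f b) (I b)"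
  shows "has_bochner_integral lborel (\<lambda>x::'a. \<Prod>b\<in>Basis. f b (x \<bullet> b)) (\<Prod>b\<in>Basis. I b)"
proof -
  interpret product_sigma_finite "\<lambda>_::'a. lborel :: real measure" ..
  have int: "integrable lborel (f b)" and I: "integral\<^sup>L lborel (f b) = I b" if "b \<in> Basis" for b
    using assms[OF that] by (auto simp: has_bochner_integral_iff)
  have meas: "f b \<in> borel_measurable borel" if "b \<in> Basis" for b
    using int[OF that] by auto
  have "has_bochner_integral (\<Pi>\<^sub>M b\<in>Basis. lborel) (\<lambda>x. \<Prod>b\<in>Basis. f b (x b)) (\<Prod>b\<in>Basis. I b)"
    using int I by (simp add: has_bochner_integral_iff product_integrable_prod product_integral_prod)
  moreover have "(\<Sum>b'\<in>Basis. x b' *\<^sub>R b') \<bullet> b = x b" if "b \<in> Basis" for x and b::'a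
    using that by (simp add: inner_sum_left inner_Basis if_distrib cong: if_cong)
  ultimately have *: "has_bochner_integral (\<Pi>\<^sub>M b\<in>Basis. lborel)
      (\<lambda>x. \<Prod>b\<in>Basis. f b ((\<Sum>b'\<in>Basis. x b' *\<^sub>R b') \<bullet> b)) (\<Prod>b\<in>Basis. I b)"
    by (simp cong: prod.cong)
  show ?thesis
    by (subst lborel_eq, rule has_bochner_integral_distr[where f="\<lambda>x. \<Prod>b\<in>Basis. f b (x \<bullet> b)", OF _ _ *])
       (use meas in \<open>auto intro!: borel_measurable_prod\<close>)
qed

text \<open>Both the squared norm and the inner product are sums over \<open>Basis\<close>; hence
  the integrand is a product of one-dimensional Gaussians with phases.\<close>

lemma has_bochner_integral_gauss:
  fixes w :: "'a::euclidean_space"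
  assumes "p > 0"
  shows "has_bochner_integral lborel (\<lambda>y. complex_of_real (exp (- p * (norm y)\<^sup>2)) * cis (w \<bullet> y))
           (complex_of_real ((pi / p) powr (real DIM('a) / 2) * exp (- (norm w)\<^sup>2 / (4 * p))))"
proof -
  have n2: "(norm y)\<^sup>2 = (\<Sum>b\<in>Basis. (y \<bullet> b)\<^sup>2)" for y :: 'a
    by (subst power2_norm_eq_inner, subst euclidean_inner) (simp add: power2_eq_square)
  have cis_sum: "cis (sum f (S::'a set)) = (\<Prod>b\<in>S. cis (f b))" if "finite S" for f S
    using that by (induction S rule: finite_induct) (auto simp flip: cis_mult)
  have cis_inner: "cis (w \<bullet> y) = (\<Prod>b\<in>Basis. cis ((w \<bullet> b) * (y \<bullet> b)))" for y
    by (subst euclidean_inner) (simp add: cis_sum)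
  have exp_norm: "exp (- c * (norm y)\<^sup>2) = (\<Prod>b\<in>Basis. exp (- c * (y \<bullet> b)\<^sup>2))" for c and y :: 'a
    by (simp add: n2 sum_distrib_left exp_sum flip: sum_negf)
  have "has_bochner_integral lborel
    (\<lambda>y::'a. \<Prod>b\<in>Basis. complex_of_real (exp (- p * (y \<bullet> b)\<^sup>2)) * cis ((w \<bullet> b) * (y \<bullet> b)))
    (\<Prod>b\<in>(Basis::'a set). complex_of_real (sqrt (pi / p) * exp (- (w \<bullet> b)\<^sup>2 / (4 * p))))"
    by (rule has_bochner_integral_lborel_prod
        [of "\<lambda>b y. complex_of_real (exp (- p * y\<^sup>2)) * cis ((w \<bullet> b) * y)"])
       (rule has_bochner_integral_gauss_real[OF assms])
  also have "(\<lambda>y::'a. \<Prod>b\<in>Basis. complex_of_real (exp (- p * (y \<bullet> b)\<^sup>2)) * cis ((w \<bullet> b) * (y \<bullet> b)))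
      = (\<lambda>y. complex_of_real (exp (- p * (norm y)\<^sup>2)) * cis (w \<bullet> y))"
    by (simp only: exp_norm cis_inner prod.distrib of_real_prod)
  also have "(\<Prod>b\<in>(Basis::'a set). complex_of_real (sqrt (pi / p) * exp (- (w \<bullet> b)\<^sup>2 / (4 * p))))
      = complex_of_real ((pi / p) powr (real DIM('a) / 2) * exp (- (norm w)\<^sup>2 / (4 * p)))"
  proof -
    have "(\<Prod>b\<in>(Basis::'a set). sqrt (pi / p) * exp (- (w \<bullet> b)\<^sup>2 / (4 * p)))
       = sqrt (pi / p) ^ DIM('a) * exp (- (norm w)\<^sup>2 / (4 * p))"
      using exp_norm[of "1 / (4 * p)" w] by (simp add: prod.distrib)
    also have "sqrt (pi / p) ^ DIM('a) = (pi / p) powr (real DIM('a) / 2)"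
      using assms by (simp add: powr_half_sqrt[symmetric] powr_powr flip: powr_realpow)
    finally show ?thesis by (simp only: of_real_prod[symmetric])
  qed
  finally show ?thesis .
qed

lemma has_bochner_integral_gauss_0:
  assumes "p > 0"
  shows "has_bochner_integral lborel (\<lambda>y::'a::euclidean_space. exp (- p * (norm y)\<^sup>2))
           ((pi / p) powr (real DIM('a) / 2))"
  using has_bochner_integral_Re[OF has_bochner_integral_gauss[OF assms, where w="0::'a"]] by simp

section \<open>Translations and tilted Gaussians\<close>

lemma has_bochner_integral_translate:
  fixes f :: "'a::euclidean_space \<Rightarrow> 'b::{banach, second_countable_topology}"
  assumes "has_bochner_integral lborel f I"
  shows "has_bochner_integral lborel (\<lambda>x. f (x + c)) I"
proof -
  have "has_bochner_integral (distr lborel borel ((+) c)) f I"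
    using assms by (simp add: lborel_distr_plus)
  moreover have "f \<in> borel_measurable borel"
    using assms by (auto simp: has_bochner_integral_iff)
  ultimately show ?thesis
    by (simp add: has_bochner_integral_iff integrable_distr_eq integral_distr add.commute)
qed

lemma integral_translate:
  fixes f :: "'a::euclidean_space \<Rightarrow> 'b::{banach, second_countable_topology}"
  assumes "f \<in> borel_measurable borel"
  shows "(\<integral>x. f (x + c) \<partial>lborel) = (\<integral>x. f x \<partial>lborel)"
proof -
  have "(\<integral>x. f x \<partial>distr lborel borel ((+) c)) = (\<integral>x. f (x + c) \<partial>lborel)"
    using assms by (subst integral_distr) (auto simp: add.commute)
  then show ?thesis by (simp add: lborel_distr_plus)
qed

text \<open>Completing the square moves the centre of the Gaussian to u. Translating back produces
  the factor exp(p |u|^2) and, from the linear phase, the factor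
  \<open>cis (w \<bullet> u)\<close>.\<close>

lemma has_bochner_integral_gauss_tilted:
  fixes u w :: "'a::euclidean_space"
  assumes "p > 0"
  shows "has_bochner_integral lborel
      (\<lambda>y. complex_of_real (exp (- p * (norm y)\<^sup>2 + 2 * p * (u \<bullet> y))) * cis (w \<bullet> y))
      (complex_of_real ((pi / p) powr (real DIM('a) / 2) * exp (p * (norm u)\<^sup>2 - (norm w)\<^sup>2 / (4 * p))) * cis (w \<bullet> u))"
proof -
  have *: "- p * (norm y)\<^sup>2 + 2 * p * (u \<bullet> y) = p * (norm u)\<^sup>2 + - p * (norm (y - u))\<^sup>2" for y
    by (simp add: power2_norm_eq_inner inner_diff_left inner_diff_right inner_commute[of u y] field_simps)
  have **: "cis (w \<bullet> y) = cis (w \<bullet> u) * cis (w \<bullet> (y - u))" for y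
    by (simp add: cis_mult inner_diff_right)
  let ?K = "complex_of_real (exp (p * (norm u)\<^sup>2)) * cis (w \<bullet> u)"
  let ?g = "\<lambda>y. complex_of_real (exp (- p * (norm y)\<^sup>2)) * cis (w \<bullet> y)"
  have "has_bochner_integral lborel (\<lambda>y. ?g (y + - u))
      (complex_of_real ((pi / p) powr (real DIM('a) / 2) * exp (- (norm w)\<^sup>2 / (4 * p))))"
    by (rule has_bochner_integral_translate[OF has_bochner_integral_gauss[OF assms, of w]])
  then have "has_bochner_integral lborel (\<lambda>y. ?K * ?g (y - u))
      (?K * complex_of_real ((pi / p) powr (real DIM('a) / 2) * exp (- (norm w)\<^sup>2 / (4 * p))))"
    unfolding add_uminus_conv_diff by (rule has_bochner_integral_mult_right)
  also have "(\<lambda>y. ?K * ?g (y - u))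
     = (\<lambda>y. complex_of_real (exp (- p * (norm y)\<^sup>2 + 2 * p * (u \<bullet> y))) * cis (w \<bullet> y))"
  proof
    fix y
    show "?K * ?g (y - u) = complex_of_real (exp (- p * (norm y)\<^sup>2 + 2 * p * (u \<bullet> y))) * cis (w \<bullet> y)"
      unfolding *[of y] **[of y] exp_add by simp
  qed
  also have "?K * complex_of_real ((pi / p) powr (real DIM('a) / 2) * exp (- (norm w)\<^sup>2 / (4 * p)))
     = complex_of_real ((pi / p) powr (real DIM('a) / 2) * exp (p * (norm u)\<^sup>2 - (norm w)\<^sup>2 / (4 * p))) * cis (w \<bullet> u)"
  proof -
    have "exp (p * (norm u)\<^sup>2 - (norm w)\<^sup>2 / (4 * p)) = exp (p * (norm u)\<^sup>2) * exp (- (norm w)\<^sup>2 / (4 * p))"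
      by (simp flip: exp_add)
    then show ?thesis by (simp only: of_real_mult mult_ac)
  qed
  finally show ?thesis .
qed

section \<open>Chirps and the modulus of their integrals\<close>

text \<open>The real tilt u is part of the definition so that the family is stable under both
  operations applied to it: a heat kernel centred at x changes a and u, up to a scalar factor, and a
  character changes v.\<close>

definition chirp :: "real \<Rightarrow> real \<Rightarrow> 'a::euclidean_space \<Rightarrow> 'a \<Rightarrow> 'a \<Rightarrow> complex" where
  "chirp a b u v y = complex_of_real (exp (- pi * a * (norm y)\<^sup>2 + 2 * pi * (u \<bullet> y)))
                     * cis (pi * b * (norm y)\<^sup>2 + 2 * pi * (v \<bullet> y))"

lemma norm_chirp: "norm (chirp a b u v y) = exp (- pi * a * (norm y)\<^sup>2 + 2 * pi * (u \<bullet> y))"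
  by (simp add: chirp_def norm_mult)

lemma borel_measurable_chirp [measurable]: "chirp a b u v \<in> borel_measurable borel"
  unfolding chirp_def[abs_def] by measurable

lemma integrable_chirp:
  fixes u v :: "'a::euclidean_space"
  assumes "a > 0"
  shows "integrable lborel (chirp a b u v)"
proof -
  have int: "integrable lborel (\<lambda>y. complex_of_real (exp (- (pi * a) * (norm y)\<^sup>2 + 2 * (pi * a) * ((u /\<^sub>R a) \<bullet> y))) * cis ((0::'a) \<bullet> y))"
    using has_bochner_integral_gauss_tilted[of "pi * a" "u /\<^sub>R a" "0::'a"] assms
    unfolding has_bochner_integral_iff by simp
  have "a * (inverse a * X) = X" for X
    using assms by simp
  note this[simp]
  show ?thesis
    by (rule Bochner_Integration.integrable_bound[OF int]) (auto simp: norm_chirp norm_mult)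
qed

text \<open>In the coordinates y, w the quadratic phase of g(x) cnj(g(x')) becomes the bilinear w.y.\<close>

lemma chirp_mult_cnj:
  "chirp a b u v (y + w /\<^sub>R 2) * cnj (chirp a b u v (y - w /\<^sub>R 2)) =
     complex_of_real (exp (- (pi * a / 2) * (norm w)\<^sup>2)) * cis (2 * pi * (v \<bullet> w)) *
     (complex_of_real (exp (- (2 * pi * a) * (norm y)\<^sup>2 + 4 * pi * (u \<bullet> y))) * cis (2 * pi * b * (w \<bullet> y)))"
proof -
  have *: "norm (y + w /\<^sub>R 2) ^ 2 = (norm y)\<^sup>2 + w \<bullet> y + (norm w)\<^sup>2 / 4"
          "norm (y - w /\<^sub>R 2) ^ 2 = (norm y)\<^sup>2 - w \<bullet> y + (norm w)\<^sup>2 / 4"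
    by (simp_all add: power2_norm_eq_inner inner_add_left inner_add_right inner_diff_left
        inner_diff_right inner_commute[of y w] field_simps)
  have split: "complex_of_real (exp (X + Y)) * cis (S + T) =
      complex_of_real (exp X) * cis S * (complex_of_real (exp Y) * cis T)" for X Y S T
    by (simp add: exp_add flip: cis_mult)
  have "chirp a b u v (y + w /\<^sub>R 2) * cnj (chirp a b u v (y - w /\<^sub>R 2)) =
     complex_of_real (exp (- pi * a * norm (y + w /\<^sub>R 2) ^ 2 + 2 * pi * (u \<bullet> (y + w /\<^sub>R 2)))
                    * exp (- pi * a * norm (y - w /\<^sub>R 2) ^ 2 + 2 * pi * (u \<bullet> (y - w /\<^sub>R 2)))) *
     (cis (pi * b * norm (y + w /\<^sub>R 2) ^ 2 + 2 * pi * (v \<bullet> (y + w /\<^sub>R 2)))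
    * cis (- (pi * b * norm (y - w /\<^sub>R 2) ^ 2 + 2 * pi * (v \<bullet> (y - w /\<^sub>R 2)))))"
    by (simp only: chirp_def complex_cnj_mult complex_cnj_complex_of_real cis_cnj of_real_mult mult_ac)
  also have "\<dots> =  complex_of_real (exp (- (pi * a / 2) * (norm w)\<^sup>2 + (- (2 * pi * a) * (norm y)\<^sup>2 + 4 * pi * (u \<bullet> y))))
     * cis (2 * pi * (v \<bullet> w) + 2 * pi * b * (w \<bullet> y))"
    unfolding exp_add[symmetric] cis_mult *
    by (intro arg_cong2[where f="(*)"] arg_cong[where f=cis] arg_cong[where f="\<lambda>x. complex_of_real (exp x)"])
       (simp_all add: inner_add_right inner_diff_right field_simps)
  also have "\<dots> = complex_of_real (exp (- (pi * a / 2) * (norm w)\<^sup>2)) * cis (2 * pi * (v \<bullet> w)) *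
     (complex_of_real (exp (- (2 * pi * a) * (norm y)\<^sup>2 + 4 * pi * (u \<bullet> y))) * cis (2 * pi * b * (w \<bullet> y)))"
    by (rule split)
  finally show ?thesis .
qed

text \<open>The left side is a double integral over pairs (x, x'); the new coordinates are the
  difference w and the midpoint y. Two translations and one use of Fubini replace the linear change
  of variables.\<close>

lemma integral_mult_cnj:
  fixes g :: "'a::euclidean_space \<Rightarrow> complex"
  assumes "integrable lborel g"
  shows "(\<integral>x. g x \<partial>lborel) * cnj (\<integral>x. g x \<partial>lborel) =
         (\<integral>w. (\<integral>y. g (y + w /\<^sub>R 2) * cnj (g (y - w /\<^sub>R 2)) \<partial>lborel) \<partial>lborel)"
proof -
  have [measurable]: "g \<in> borel_measurable borel" using assms by auto
  have [measurable]: "(\<lambda>y. cnj (g y)) \<in> borel_measurable borel"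
    by (rule borel_measurable_continuous_on[of cnj]) (auto intro!: continuous_intros)
  have shift: "integrable lborel (\<lambda>w. g (w + y))" "(\<integral>w. g (w + y) \<partial>lborel) = (\<integral>w. g w \<partial>lborel)" for y
    using has_bochner_integral_translate[of g "integral\<^sup>L lborel g" y] assms
    by (auto simp: has_bochner_integral_iff)
  have nshift: "(\<integral>w. norm (g (w + y)) \<partial>lborel) = (\<integral>w. norm (g w) \<partial>lborel)" for y
    by (rule integral_translate[where f="\<lambda>x. norm (g x)"]) simp
  have "integrable (lborel \<Otimes>\<^sub>M lborel) (\<lambda>(y, w). cnj (g y) * g (w + y))"
    by (rule lborel_pair.Fubini_integrable) (use assms shift in \<open>auto simp: norm_mult nshift\<close>)
  note Fub = lborel_pair.Fubini_integral[OF this]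
  have "(\<integral>x. g x \<partial>lborel) * cnj (\<integral>x. g x \<partial>lborel) = (\<integral>y. cnj (g y) * (\<integral>w. g w \<partial>lborel) \<partial>lborel)"
    by (simp add: mult.commute)
  also have "\<dots> = (\<integral>y. (\<integral>w. cnj (g y) * g (w + y) \<partial>lborel) \<partial>lborel)"
    by (simp add: shift)
  also have "\<dots> = (\<integral>w. (\<integral>y. cnj (g y) * g (w + y) \<partial>lborel) \<partial>lborel)"
    by (rule Fub[symmetric])
  also have "(\<lambda>w. \<integral>y. cnj (g y) * g (w + y) \<partial>lborel) = (\<lambda>w. \<integral>y. g (y + w /\<^sub>R 2) * cnj (g (y - w /\<^sub>R 2)) \<partial>lborel)"
  proof
    fix w :: 'a
    have *: "w + (y + - (w /\<^sub>R 2)) = y + w /\<^sub>R 2" for y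
      using scaleR_half_double[of w] by (simp add: algebra_simps)
    have "(\<integral>y. cnj (g y) * g (w + y) \<partial>lborel)
        = (\<integral>y. cnj (g (y + - (w /\<^sub>R 2))) * g (w + (y + - (w /\<^sub>R 2))) \<partial>lborel)"
      by (rule integral_translate[symmetric]) simp
    then show "(\<integral>y. cnj (g y) * g (w + y) \<partial>lborel) = (\<integral>y. g (y + w /\<^sub>R 2) * cnj (g (y - w /\<^sub>R 2)) \<partial>lborel)"
      unfolding * by (simp only: add_uminus_conv_diff mult.commute)
  qed
  finally show ?thesis .
qed

text \<open>
  The square of the modulus of a complex Gaussian integral is an iterated integral in which
  only real Gaussians with a linear phase have to be integrated; this avoids analytic continuation and
  branches of the complex square root.
\<close>

lemma norm_integral_chirp:
  fixes u v :: "'a::euclidean_space"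
  assumes "a > 0"
  shows "norm (\<integral>y. chirp a b u v y \<partial>lborel) =
     (a\<^sup>2 + b\<^sup>2) powr (- real DIM('a) / 4) *
     exp (pi * (a * ((norm u)\<^sup>2 - (norm v)\<^sup>2) - 2 * b * (u \<bullet> v)) / (a\<^sup>2 + b\<^sup>2))"
proof -
  define I where "I = (\<integral>y. chirp a b u v y \<partial>lborel)"
  define D where "D = a\<^sup>2 + b\<^sup>2"
  define d where "d = real DIM('a) / 2"
  \<comment> \<open>After the integration over y, a Gaussian in w with decay rate \<open>q\<close>
    remains: pi a / 2 is present from the start, and pi b^2 / (2 a) comes from the inner integral
    with frequency 2 pi b w. The vector \<open>?w\<close> below is its total frequency; the share of
    u arises because the inner Gaussian is centred at u / a.\<close>
  define q where "q = pi * D / (2 * a)"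
  have D: "D > 0" using assms by (simp add: D_def add_pos_nonneg)
  have q: "q > 0" using D assms by (simp add: q_def)
  define E where "E = (pi * (a * ((norm u)\<^sup>2 - (norm v)\<^sup>2) - 2 * b * (u \<bullet> v)) / D)"
  define K where "K = (1 / (2 * a)) powr d * exp (2 * pi * (norm u)\<^sup>2 / a)"
  let ?w = "(2 * pi) *\<^sub>R (v + (b / a) *\<^sub>R u)"
  have inner: "(\<integral>y. chirp a b u v (y + w /\<^sub>R 2) * cnj (chirp a b u v (y - w /\<^sub>R 2)) \<partial>lborel)
      = complex_of_real K * (complex_of_real (exp (- q * (norm w)\<^sup>2)) * cis (?w \<bullet> w))" for w
  proof -
    have "(\<integral>y. chirp a b u v (y + w /\<^sub>R 2) * cnj (chirp a b u v (y - w /\<^sub>R 2)) \<partial>lborel)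
      = complex_of_real (exp (- (pi * a / 2) * (norm w)\<^sup>2)) * cis (2 * pi * (v \<bullet> w)) *
        (\<integral>y. complex_of_real (exp (- (2 * pi * a) * (norm y)\<^sup>2 + 4 * pi * (u \<bullet> y))) * cis (2 * pi * b * (w \<bullet> y)) \<partial>lborel)"
      unfolding chirp_mult_cnj by (rule integral_mult_right_zero)
    also have "(\<integral>y. complex_of_real (exp (- (2 * pi * a) * (norm y)\<^sup>2 + 4 * pi * (u \<bullet> y))) * cis (2 * pi * b * (w \<bullet> y)) \<partial>lborel)
      = complex_of_real ((1 / (2 * a)) powr d * exp (2 * pi * (norm u)\<^sup>2 / a - (pi * b\<^sup>2 / (2 * a)) * (norm w)\<^sup>2)) * cis (2 * pi * (b / a) * (u \<bullet> w))"
    proof -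
      have "integral\<^sup>L lborel (\<lambda>y. complex_of_real (exp (- (2 * pi * a) * (norm y)\<^sup>2 + 2 * (2 * pi * a) * ((u /\<^sub>R a) \<bullet> y))) * cis (((2 * pi * b) *\<^sub>R w) \<bullet> y))
        = complex_of_real ((pi / (2 * pi * a)) powr (real DIM('a) / 2) * exp ((2 * pi * a) * (norm (u /\<^sub>R a))\<^sup>2 - (norm ((2 * pi * b) *\<^sub>R w))\<^sup>2 / (4 * (2 * pi * a)))) *
          cis (((2 * pi * b) *\<^sub>R w) \<bullet> (u /\<^sub>R a))"
        by (rule has_bochner_integral_integral_eq, rule has_bochner_integral_gauss_tilted) (use assms in simp)
      also have "(\<lambda>y. complex_of_real (exp (- (2 * pi * a) * (norm y)\<^sup>2 + 2 * (2 * pi * a) * ((u /\<^sub>R a) \<bullet> y))) * cis (((2 * pi * b) *\<^sub>R w) \<bullet> y))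
        = (\<lambda>y. complex_of_real (exp (- (2 * pi * a) * (norm y)\<^sup>2 + 4 * pi * (u \<bullet> y))) * cis (2 * pi * b * (w \<bullet> y)))"
        using assms by auto
      also have "(2 * pi * a) * (norm (u /\<^sub>R a))\<^sup>2 - (norm ((2 * pi * b) *\<^sub>R w))\<^sup>2 / (4 * (2 * pi * a))
        = 2 * pi * (norm u)\<^sup>2 / a - (pi * b\<^sup>2 / (2 * a)) * (norm w)\<^sup>2"
        using assms by (simp add: power_mult_distrib power2_eq_square field_simps)
      also have "((2 * pi * b) *\<^sub>R w) \<bullet> (u /\<^sub>R a) = 2 * pi * (b / a) * (u \<bullet> w)"
        by (simp add: inner_commute divide_inverse)
      also have "pi / (2 * pi * a) = 1 / (2 * a)" by simp
      finally show ?thesis by (simp only: d_def)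
    qed
    also have "complex_of_real (exp (- (pi * a / 2) * (norm w)\<^sup>2)) * cis (2 * pi * (v \<bullet> w)) *
        (complex_of_real ((1 / (2 * a)) powr d * exp (2 * pi * (norm u)\<^sup>2 / a - (pi * b\<^sup>2 / (2 * a)) * (norm w)\<^sup>2)) * cis (2 * pi * (b / a) * (u \<bullet> w)))
      = complex_of_real ((1 / (2 * a)) powr d * (exp (- (pi * a / 2) * (norm w)\<^sup>2) * exp (2 * pi * (norm u)\<^sup>2 / a - (pi * b\<^sup>2 / (2 * a)) * (norm w)\<^sup>2)))
        * (cis (2 * pi * (v \<bullet> w)) * cis (2 * pi * (b / a) * (u \<bullet> w)))"
      by (simp only: of_real_mult mult_ac)
    also have "cis (2 * pi * (v \<bullet> w)) * cis (2 * pi * (b / a) * (u \<bullet> w)) = cis (?w \<bullet> w)"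
      by (simp add: cis_mult inner_add_left distrib_left mult.assoc)
    also have "exp (- (pi * a / 2) * (norm w)\<^sup>2) * exp (2 * pi * (norm u)\<^sup>2 / a - (pi * b\<^sup>2 / (2 * a)) * (norm w)\<^sup>2)
       = exp (2 * pi * (norm u)\<^sup>2 / a) * exp (- q * (norm w)\<^sup>2)"
    proof -
      have "- (pi * a / 2) * (norm w)\<^sup>2 + (2 * pi * (norm u)\<^sup>2 / a - (pi * b\<^sup>2 / (2 * a)) * (norm w)\<^sup>2)
         = 2 * pi * (norm u)\<^sup>2 / a + - q * (norm w)\<^sup>2"
        using assms by (simp add: q_def D_def field_simps power2_eq_square)
      then show ?thesis by (simp only: exp_add[symmetric])
    qed
    finally show ?thesis by (simp only: K_def of_real_mult mult_ac)
  qed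
  have "complex_of_real ((norm I)\<^sup>2) = I * cnj I"
    by (rule complex_norm_square)
  also have "\<dots> = (\<integral>w. complex_of_real K * (complex_of_real (exp (- q * (norm w)\<^sup>2)) * cis (?w \<bullet> w)) \<partial>lborel)"
    unfolding I_def integral_mult_cnj[OF integrable_chirp[OF assms]] inner ..
  also have "\<dots> = complex_of_real K * (\<integral>w. complex_of_real (exp (- q * (norm w)\<^sup>2)) * cis (?w \<bullet> w) \<partial>lborel)"
    by (rule integral_mult_right_zero)
  also have "\<dots> = complex_of_real (K * ((pi / q) powr d * exp (- (norm ?w)\<^sup>2 / (4 * q))))"
    unfolding has_bochner_integral_integral_eq[OF has_bochner_integral_gauss[OF q]] d_def of_real_mult ..
  finally have "(norm I)\<^sup>2 = K * ((pi / q) powr d * exp (- (norm ?w)\<^sup>2 / (4 * q)))"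
    by (simp only: of_real_eq_iff)
  also have "\<dots> = ((1 / (2 * a)) powr d * (pi / q) powr d) * exp (2 * pi * (norm u)\<^sup>2 / a + - (norm ?w)\<^sup>2 / (4 * q))"
    by (simp only: K_def exp_add mult_ac)
  also have "(1 / (2 * a)) powr d * (pi / q) powr d = D powr (- d)"
  proof -
    have "(1 / (2 * a)) powr d * (pi / q) powr d = (1 / (2 * a) * (pi / q)) powr d"
      by (rule powr_mult[symmetric])
    also have "1 / (2 * a) * (pi / q) = inverse D"
      using assms D by (simp add: q_def field_simps)
    finally show ?thesis using D by (simp add: powr_minus inverse_powr)
  qed
  \<comment> \<open>The two terms in |u|^2 combine through D - b^2 = a^2, which removes the division
    by a.\<close>
  also have "2 * pi * (norm u)\<^sup>2 / a + - (norm ?w)\<^sup>2 / (4 * q) = 2 * E"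
  proof -
    have nw: "(norm ?w)\<^sup>2 = 4 * pi\<^sup>2 * ((norm v)\<^sup>2 + 2 * (b / a) * (u \<bullet> v) + (b / a)\<^sup>2 * (norm u)\<^sup>2)"
      unfolding power2_norm_eq_inner
      by (simp add: inner_add_left inner_add_right inner_commute[of v u] power2_eq_square algebra_simps)
    have nu: "2 * pi * (norm u)\<^sup>2 / a = 2 * pi * (norm u)\<^sup>2 * (a\<^sup>2 + b\<^sup>2) / (a * D)"
      using D assms by (simp add: D_def[symmetric])
    have nq: "4 * pi\<^sup>2 * X / (4 * q) = 2 * pi * a * X / D" for X
      using D assms by (simp add: q_def power2_eq_square)
    show ?thesis
      unfolding minus_divide_left[symmetric] nw nq nu E_def using D assms by (simp add: field_simps power2_eq_square)
  qed
  also have "D powr (- d) * exp (2 * E) = (D powr (- real DIM('a) / 4) * exp E)\<^sup>2"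
  proof -
    have "D powr (- d) = (D powr (- real DIM('a) / 4)) ^ 2"
      using D by (simp add: d_def power2_eq_square flip: powr_add)
    then show ?thesis by (simp add: power_mult_distrib exp_double)
  qed
  finally have "norm I = D powr (- real DIM('a) / 4) * exp E"
    by (simp add: power2_eq_iff_nonneg)
  then show ?thesis by (simp add: I_def D_def E_def)
qed

section \<open>The heat flow of a chirp\<close>

text \<open>The integrand is a scalar multiple of a chirp with decay rate s + a and tilt s x, so
  \<open>norm_integral_chirp\<close> gives its integral's modulus exactly. The exponent is a
  quadratic function of x, and the bound is its maximum, attained at x = - (b / E) v with E = a (s +
  a) + b^2.\<close>

lemma norm_heat_integral_chirp_le:
  fixes x v :: "'a::euclidean_space"
  assumes "a > 0" "t > 0" and s: "s = 1 / (4 * pi * t)"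
  shows "norm (\<integral>y. heat_kernel t (x - y) *\<^sub>R chirp a b 0 v y \<partial>lborel) \<le>
     (s\<^sup>2 / ((s + a)\<^sup>2 + b\<^sup>2)) powr (real DIM('a) / 4) * exp (- pi * a * (norm v)\<^sup>2 / (a * (s + a) + b\<^sup>2))"
proof -
  define c where "c = s + a"
  define D where "D = c\<^sup>2 + b\<^sup>2"
  define E where "E = a * c + b\<^sup>2"
  define P where "P = s powr (real DIM('a) / 2) * exp (- pi * s * (norm x)\<^sup>2)"
  define Q where "Q = (c * ((norm (s *\<^sub>R x))\<^sup>2 - (norm v)\<^sup>2) - 2 * b * ((s *\<^sub>R x) \<bullet> v)) / D"
  have s0: "s > 0" using assms by simp
  have c: "c > 0" using s0 assms(1) unfolding c_def by linarith
  have D: "D > 0" and E: "E > 0" using c assms by (auto simp: D_def E_def add_pos_nonneg)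
  have kernel: "heat_kernel t (x - y) *\<^sub>R chirp a b 0 v y = P *\<^sub>R chirp c b (s *\<^sub>R x) v y" for y
  proof -
    have pw: "(4 * pi * t) powr (- real DIM('a) / 2) = s powr (real DIM('a) / 2)"
      using assms by (simp add: powr_minus_divide powr_divide)
    have st: "N / (4 * t) = pi * s * N" for N
      using assms by simp
    have "- (norm (x - y))\<^sup>2 / (4 * t) + (- pi * a * (norm y)\<^sup>2) =
        - pi * s * (norm x)\<^sup>2 + (- pi * c * (norm y)\<^sup>2 + 2 * pi * ((s *\<^sub>R x) \<bullet> y))"
      unfolding minus_divide_left[symmetric] st c_def power2_norm_eq_inner
      by (simp add: inner_diff_left inner_diff_right inner_commute[of y x] algebra_simps)
    then have "exp (- (norm (x - y))\<^sup>2 / (4 * t)) * exp (- pi * a * (norm y)\<^sup>2) =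
        exp (- pi * s * (norm x)\<^sup>2) * exp (- pi * c * (norm y)\<^sup>2 + 2 * pi * ((s *\<^sub>R x) \<bullet> y))"
      by (simp only: exp_add[symmetric])
    then have "heat_kernel t (x - y) * exp (- pi * a * (norm y)\<^sup>2) =
       P * exp (- pi * c * (norm y)\<^sup>2 + 2 * pi * ((s *\<^sub>R x) \<bullet> y))"
      by (simp only: heat_kernel_def P_def mult.assoc pw[unfolded mult.assoc])
    then have "complex_of_real (heat_kernel t (x - y)) * complex_of_real (exp (- pi * a * (norm y)\<^sup>2)) =
       complex_of_real P * complex_of_real (exp (- pi * c * (norm y)\<^sup>2 + 2 * pi * ((s *\<^sub>R x) \<bullet> y)))"
      by (simp only: of_real_mult[symmetric])
    then show ?thesis
      unfolding chirp_def scaleR_conv_of_real mult.assoc[symmetric]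
      by (simp only: inner_zero_left mult_zero_right add_0_right)
  qed
  have P0: "P \<ge> 0" by (simp add: P_def)
  have "norm (\<integral>y. heat_kernel t (x - y) *\<^sub>R chirp a b 0 v y \<partial>lborel) = P * norm (\<integral>y. chirp c b (s *\<^sub>R x) v y \<partial>lborel)"
    unfolding kernel integral_scaleR_right using P0 by simp
  also have "\<dots> = P * (D powr (- real DIM('a) / 4) * exp (pi * Q))"
    unfolding norm_integral_chirp[OF c] Q_def D_def by simp
  also have "\<dots> = (s powr (real DIM('a) / 2) * D powr (- real DIM('a) / 4)) * exp (- pi * s * (norm x)\<^sup>2 + pi * Q)"
    unfolding exp_add P_def by (simp only: mult_ac)
  also have "s powr (real DIM('a) / 2) * D powr (- real DIM('a) / 4) = (s\<^sup>2 / D) powr (real DIM('a) / 4)"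
  proof -
    have "(s\<^sup>2) powr (real DIM('a) / 4) = s powr (real DIM('a) / 2)"
      using s0 by (simp add: powr_powr flip: powr_numeral)
    then show ?thesis using s0 D by (simp add: powr_minus_divide powr_divide)
  qed
  also have "exp (- pi * s * (norm x)\<^sup>2 + pi * Q) \<le> exp (- pi * a * (norm v)\<^sup>2 / E)"
  proof -
    have sq: "(norm (E *\<^sub>R x + b *\<^sub>R v))\<^sup>2 = E\<^sup>2 * (norm x)\<^sup>2 + 2 * b * E * (x \<bullet> v) + b\<^sup>2 * (norm v)\<^sup>2"
      unfolding power2_norm_eq_inner
      by (simp add: inner_add_left inner_add_right inner_commute[of v x] power2_eq_square algebra_simps)
    have id1: "Q - s * (norm x)\<^sup>2 = (c * (s\<^sup>2 * (norm x)\<^sup>2 - (norm v)\<^sup>2) - 2 * b * s * (x \<bullet> v) - s * (norm x)\<^sup>2 * D) / D"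
      using D by (simp add: Q_def power_mult_distrib field_simps)
    \<comment> \<open>With denominators cleared, the distance of the exponent from its maximum is a
      negative multiple of a perfect square; the identity rests on c - a = s.\<close>
    have "E * (c * (s\<^sup>2 * (norm x)\<^sup>2 - (norm v)\<^sup>2) - 2 * b * s * (x \<bullet> v) - s * (norm x)\<^sup>2 * D) + a * (norm v)\<^sup>2 * D
        = - s * (norm (E *\<^sub>R x + b *\<^sub>R v))\<^sup>2"
      unfolding sq by (simp add: E_def D_def c_def power2_eq_square algebra_simps)
    also have "\<dots> \<le> 0" using s0 by simp
    finally have "(Q - s * (norm x)\<^sup>2) \<le> - (a * (norm v)\<^sup>2 / E)"
      unfolding id1 using D E by (simp add: field_simps)
    then have "pi * (Q - s * (norm x)\<^sup>2) \<le> pi * - (a * (norm v)\<^sup>2 / E)"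
      by (rule mult_left_mono) simp
    then show ?thesis by (simp add: algebra_simps)
  qed
  finally show ?thesis by (simp add: D_def E_def c_def mult_left_mono)
qed

section \<open>Fourier transforms and lower bounds for the weak norm\<close>

text \<open>The character at \<xi> merely shifts the frequency v. As \<open>fourier\<close> takes
  real functions, the transform of the complex chirp is assembled from those of its real and
  imaginary parts.\<close>

lemma fourier_chirp:
  fixes v \<xi> :: "'a::euclidean_space"
  assumes "a > 0"
  shows "fourier (\<lambda>y. A * Re (chirp a b 0 v y)) \<xi> + \<i> * fourier (\<lambda>y. A * Im (chirp a b 0 v y)) \<xi>
    = A *\<^sub>R (\<integral>y. chirp a b 0 (v - \<xi>) y \<partial>lborel)"
proof -
  have int: "integrable lborel (chirp a b 0 v)" by (rule integrable_chirp[OF assms])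
  have "integrable lborel (\<lambda>y. cis (- 2 * pi * (y \<bullet> \<xi>)) * complex_of_real (A * Re (chirp a b 0 v y)))"
    by (rule Bochner_Integration.integrable_bound[OF integrable_norm[OF integrable_scaleR_right[OF int, of A]]])
       (auto simp: norm_mult intro!: mult_left_mono abs_Re_le_cmod)
  moreover have "integrable lborel (\<lambda>y. cis (- 2 * pi * (y \<bullet> \<xi>)) * complex_of_real (A * Im (chirp a b 0 v y)))"
    by (rule Bochner_Integration.integrable_bound[OF integrable_norm[OF integrable_scaleR_right[OF int, of A]]])
       (auto simp: norm_mult intro!: mult_left_mono abs_Im_le_cmod)
  ultimately have "fourier (\<lambda>y. A * Re (chirp a b 0 v y)) \<xi> + \<i> * fourier (\<lambda>y. A * Im (chirp a b 0 v y)) \<xi>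
    = (\<integral>y. cis (- 2 * pi * (y \<bullet> \<xi>)) * complex_of_real (A * Re (chirp a b 0 v y)) +
         \<i> * (cis (- 2 * pi * (y \<bullet> \<xi>)) * complex_of_real (A * Im (chirp a b 0 v y))) \<partial>lborel)"
    unfolding fourier_def by (subst Bochner_Integration.integral_add) simp_all
  also have "\<dots> = (\<integral>y. A *\<^sub>R chirp a b 0 (v - \<xi>) y \<partial>lborel)"
  proof (rule Bochner_Integration.integral_cong[OF refl])
    fix y
    have "cis (- 2 * pi * (y \<bullet> \<xi>)) * complex_of_real (A * Re (chirp a b 0 v y)) +
         \<i> * (cis (- 2 * pi * (y \<bullet> \<xi>)) * complex_of_real (A * Im (chirp a b 0 v y)))
       = complex_of_real A * (cis (- 2 * pi * (y \<bullet> \<xi>)) * chirp a b 0 v y)"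
      by (subst (3) complex_eq) (simp add: algebra_simps)
    also have "cis (- 2 * pi * (y \<bullet> \<xi>)) * chirp a b 0 v y = chirp a b 0 (v - \<xi>) y"
    proof -
      have "cis (pi * b * (norm y)\<^sup>2 + 2 * pi * ((v - \<xi>) \<bullet> y)) =
            cis (- 2 * pi * (y \<bullet> \<xi>)) * cis (pi * b * (norm y)\<^sup>2 + 2 * pi * (v \<bullet> y))"
        unfolding cis_mult by (rule arg_cong[where f=cis]) (simp add: inner_diff_left inner_commute[of y \<xi>] algebra_simps)
      then show ?thesis by (simp add: chirp_def)
    qed
    finally show "cis (- 2 * pi * (y \<bullet> \<xi>)) * complex_of_real (A * Re (chirp a b 0 v y)) +
         \<i> * (cis (- 2 * pi * (y \<bullet> \<xi>)) * complex_of_real (A * Im (chirp a b 0 v y))) = A *\<^sub>R chirp a b 0 (v - \<xi>) y"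
      by (simp only: scaleR_conv_of_real)
  qed
  finally show ?thesis by simp
qed

lemma borel_measurable_fourier_riesz [measurable]:
  fixes f :: "'a::euclidean_space \<Rightarrow> real"
  assumes [measurable]: "f \<in> borel_measurable borel"
  shows "fourier_riesz \<alpha> f \<in> borel_measurable borel"
  unfolding fourier_riesz_def[abs_def] fourier_def[abs_def] by measurable

text \<open>A single level t bounds the supremum from below. The bound W is compared with
  \<open>emeasure\<close>, so that superlevel sets of infinite measure are covered as well.\<close>

lemma weak_Lr_norm_ge:
  fixes g :: "'a::euclidean_space \<Rightarrow> 'b::real_normed_vector"
  assumes "t > 0" "r > 0" "W \<ge> 0" "ennreal W \<le> emeasure lborel {x. t < norm (g x)}"
  shows "ennreal (t * W powr (1 / r)) \<le> weak_Lr_norm r g"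
proof -
  let ?S = "{x. t < norm (g x)}"
  have "ennreal (t * W powr (1 / r)) \<le>
     (if emeasure lborel ?S = \<infinity> then \<infinity> else ennreal (t * measure lborel ?S powr (1 / r)))"
  proof (cases "emeasure lborel ?S = \<infinity>")
    case False
    then have "ennreal W \<le> ennreal (measure lborel ?S)"
      using assms by (simp add: emeasure_eq_ennreal_measure)
    then have "W \<le> measure lborel ?S" by (simp add: ennreal_le_iff)
    then show ?thesis using False assms by (auto intro!: ennreal_leI mult_left_mono powr_mono2)
  qed simp
  also have "\<dots> \<le> weak_Lr_norm r g"
    unfolding weak_Lr_norm_def by (rule SUP_upper2[of t]) (use assms in auto)
  finally show ?thesis .
qed

text \<open>Pigeonhole by subadditivity. It serves to select the real or the imaginary part of the
  chirp, whichever is large on half of a ball.\<close>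

lemma emeasure_Un_half:
  assumes "S \<in> sets M" "T \<in> sets M" "B \<subseteq> S \<union> T" "emeasure M B = ennreal W" "W \<ge> 0"
  shows "ennreal (W / 2) \<le> emeasure M S \<or> ennreal (W / 2) \<le> emeasure M T"
proof (rule ccontr)
  assume neg: "\<not> ?thesis"
  have "ennreal W \<le> emeasure M (S \<union> T)"
    using assms emeasure_mono[of B "S \<union> T" M] by auto
  also have "\<dots> \<le> emeasure M S + emeasure M T"
    by (rule emeasure_subadditive) (use assms in auto)
  also have "\<dots> < ennreal (W / 2) + ennreal (W / 2)"
    using neg by (intro add_strict_mono) auto
  also have "\<dots> = ennreal W"
    using assms by (simp flip: ennreal_plus)
  finally show False by simp
qed

section \<open>Functions at scale K with uniform bounds\<close>

text \<open>One term of the exponential series is at most the whole sum. With x = K^(2 eps) this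
  makes the Gaussian gain absorb any fixed power of K.\<close>

lemma power_div_fact_le_exp:
  fixes x :: real
  assumes "x \<ge> 0"
  shows "x ^ m / fact m \<le> exp x"
proof -
  have "(\<Sum>n\<in>{m}. x ^ n /\<^sub>R fact n) \<le> (\<Sum>n. x ^ n /\<^sub>R fact n)"
    by (rule sum_le_suminf) (use assms summable_exp_generic[of x] in auto)
  then show ?thesis by (simp add: exp_def divide_inverse mult.commute)
qed

text \<open>The heat kernel is real, so taking the real or imaginary part commutes with the
  convolution.\<close>

lemma heat_conv_Re_Im_chirp_le:
  fixes x v :: "'a::euclidean_space" and P :: "complex \<Rightarrow> real"
  assumes "a > 0" "t > 0" "A \<ge> 0" and P: "P = Re \<or> P = Im"
  shows "\<bar>heat_conv t (\<lambda>y. A * P (chirp a b 0 v y)) x\<bar> \<le>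
    A * norm (\<integral>y. heat_kernel t (x - y) *\<^sub>R chirp a b 0 v y \<partial>lborel)"
proof -
  have [measurable]: "heat_kernel t \<in> borel_measurable (borel :: 'a measure)"
    unfolding heat_kernel_def[abs_def] by measurable
  have "norm (heat_kernel t (x - y)) \<le> (4 * pi * t) powr (- real DIM('a) / 2)" for y
    using assms by (simp add: heat_kernel_def mult_left_le)
  then have "integrable lborel (\<lambda>y. heat_kernel t (x - y) *\<^sub>R chirp a b 0 v y)"
    by (intro Bochner_Integration.integrable_bound[OF integrable_scaleR_right
          [OF integrable_norm[OF integrable_chirp[OF assms(1), of b 0 v]], of "(4 * pi * t) powr (- real DIM('a) / 2)"]])
       (auto intro!: mult_right_mono AE_I2)
  then have "P (\<integral>y. heat_kernel t (x - y) *\<^sub>R chirp a b 0 v y \<partial>lborel) =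
      (\<integral>y. heat_kernel t (x - y) * P (chirp a b 0 v y) \<partial>lborel)"
    using P by (auto simp flip: integral_Re integral_Im)
  then have "heat_conv t (\<lambda>y. A * P (chirp a b 0 v y)) x =
      A * P (\<integral>y. heat_kernel t (x - y) *\<^sub>R chirp a b 0 v y \<partial>lborel)"
    unfolding heat_conv_def by (simp add: mult.left_commute)
  then show ?thesis
    using P assms abs_Re_le_cmod abs_Im_le_cmod by (auto simp: abs_mult intro!: mult_left_mono)
qed

text \<open>The construction at one fixed scale K, with all constants explicit: the upper bounds 1
  and m! do not involve K, and the lower bound is a constant times a power of K. The condition on m
  gives K^d \<le> (K^(2 eps))^m \<le> m! exp(K^(2 eps)), which is the source of m!.\<close>

lemma chirp_family:
  fixes \<beta> \<alpha> r \<epsilon> K :: real and m :: nat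
  defines "d \<equiv> real DIM('a::euclidean_space)"
  assumes beta: "0 < \<beta>" "\<beta> \<le> d" and alpha: "0 < \<alpha>" and r: "0 < r" and eps: "0 < \<epsilon>"
    and m: "d \<le> 2 * \<epsilon> * real m" and K: "K \<ge> 1"
  shows "\<exists>\<Phi> :: 'a \<Rightarrow> real.
     integrable lborel \<Phi> \<and> (\<integral>x. \<bar>\<Phi> x\<bar> \<partial>lborel) \<le> 1 \<and>
     (\<forall>t>0. \<forall>x. t powr ((d - \<beta>) / 2) * \<bar>heat_conv t \<Phi> x\<bar> \<le> fact m) \<and>
     ennreal ((4 * pi) powr (- \<alpha>) * 2 powr (- d / 4) * exp (- pi) / 3 * (unit_ball_vol d / 2) powr (1 / r) *
       K powr (d / r - \<alpha> * (1 + \<epsilon>) - \<beta> / 2)) \<le> weak_Lr_norm r (fourier_riesz \<alpha> \<Phi>)"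
proof -
  obtain e :: 'a where e: "e \<in> Basis" using nonempty_Basis by blast
  define a where "a = K powr (2 - 2 * \<beta> / d)"
  define b where "b = K powr (2 - \<beta> / d)"
  define A where "A = K powr (d - \<beta>)"
  define R where "R = K powr (1 + \<epsilon>)"
  define v where "v = R *\<^sub>R e"
  define F where "F P = (\<lambda>y. A * P (chirp a b 0 v y))" for P :: "complex \<Rightarrow> real"
  have d: "d \<ge> 1" using DIM_positive[where 'a='a] by (simp add: d_def)
  have bd: "\<beta> / d \<le> 1" "0 < \<beta> / d" using beta d by auto
  have a1: "a \<ge> 1" and b1: "b \<ge> 1" and RK: "K \<le> R" and aK: "a \<le> K\<^sup>2" and ab: "a \<le> b"
    using K bd eps powr_mono[of 1 "1 + \<epsilon>" K] powr_mono[of "2 - 2 * \<beta> / d" 2 K]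
      powr_mono[of "2 - 2 * \<beta> / d" "2 - \<beta> / d" K]
    by (auto simp: a_def b_def R_def intro!: ge_one_powr_ge_zero)
  have A0: "A > 0" and a0: "a > 0" and b0: "b > 0" and R0: "R > 0" and K0: "K > 0"
    using K a1 b1 RK by (auto simp: A_def)
  \<comment> \<open>The transform of the chirp has modulus proportional to exp(- pi a |\<xi> - v|^2
    / (a^2 + b^2)). By this identity and a \<le> b, the quotient (a^2 + b^2) / a lies between K^2
    and 2 K^2, so K is the width on the Fourier side.\<close>
  have bsq: "b\<^sup>2 = a * K\<^sup>2"
  proof -
    have "b\<^sup>2 = K powr (2 * (2 - \<beta> / d))" using K0 by (simp add: b_def powr_powr mult.commute flip: powr_numeral)
    also have "2 * (2 - \<beta> / d) = (2 - 2 * \<beta> / d) + 2" by simp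
    also have "K powr \<dots> = a * K\<^sup>2" using K0 by (subst powr_add) (simp add: a_def)
    finally show ?thesis .
  qed
  \<comment> \<open>This is the normalisation of the envelope: \<open>A\<close> cancels the Gaussian
    integral (1 / a)^(d/2), which gives mass 1.\<close>
  have ad: "a powr (d / 2) = A"
  proof -
    have "(2 - 2 * \<beta> / d) * (d / 2) = d - \<beta>" using d by (simp add: field_simps)
    then show ?thesis by (simp only: a_def A_def powr_powr)
  qed
  have normv: "norm v = R" using e R0 by (simp add: v_def)
  have int: "integrable lborel (F P)" and L1: "(\<integral>x. \<bar>F P x\<bar> \<partial>lborel) \<le> 1" if P: "P = Re \<or> P = Im" for P
  proof -
    have g: "has_bochner_integral lborel (\<lambda>y::'a. A * exp (- (pi * a) * (norm y)\<^sup>2)) (A * (pi / (pi * a)) powr (real DIM('a) / 2))"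
      by (rule has_bochner_integral_mult_right, rule has_bochner_integral_gauss_0) (use a0 in simp)
    have le: "\<bar>F P y\<bar> \<le> A * exp (- (pi * a) * (norm y)\<^sup>2)" for y
    proof -
      have "\<bar>P (chirp a b 0 v y)\<bar> \<le> norm (chirp a b 0 v y)"
        using P abs_Re_le_cmod abs_Im_le_cmod by auto
      then show ?thesis using A0 by (simp add: F_def abs_mult norm_chirp mult_left_mono)
    qed
    have meas: "F P \<in> borel_measurable borel"
      using P unfolding F_def[abs_def] by auto
    show int: "integrable lborel (F P)"
      by (rule Bochner_Integration.integrable_bound[OF integrable.intros[OF g]])
         (use le meas A0 in auto)
    have "(\<integral>x. \<bar>F P x\<bar> \<partial>lborel) \<le> (\<integral>y. A * exp (- (pi * a) * (norm y)\<^sup>2) \<partial>(lborel :: 'a measure))"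
      by (rule integral_mono) (use int g le in \<open>auto simp: has_bochner_integral_iff\<close>)
    also have "\<dots> = A * (1 / a) powr (d / 2)"
      using has_bochner_integral_integral_eq[OF g] a0 by (simp add: d_def)
    also have "\<dots> = 1" using A0 by (simp add: powr_divide ad)
    finally show "(\<integral>x. \<bar>F P x\<bar> \<partial>lborel) \<le> 1" .
  qed
  have heat: "t powr ((d - \<beta>) / 2) * \<bar>heat_conv t (F P) x\<bar> \<le> fact m" if P: "P = Re \<or> P = Im" and t: "t > 0" for P t x
  proof -
    define s where "s = 1 / (4 * pi * t)"
    define D where "D = (s + a)\<^sup>2 + b\<^sup>2"
    define X where "X = (s\<^sup>2 / D) powr (d / 4)"
    define Y where "Y = exp (- pi * a * R\<^sup>2 / (a * (s + a) + b\<^sup>2))"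
    have s: "s > 0" using t by (simp add: s_def)
    have D1: "1 \<le> D" and Ds: "s\<^sup>2 \<le> D"
    proof -
      have "1 \<le> b\<^sup>2" using b1 by simp
      then show "1 \<le> D" unfolding D_def using zero_le_power2[of "s + a"] by linarith
      have "s\<^sup>2 \<le> (s + a)\<^sup>2" using s a0 by (intro power_mono) auto
      then show "s\<^sup>2 \<le> D" unfolding D_def using zero_le_power2[of b] by linarith
    qed
    have "t powr ((d - \<beta>) / 2) \<le> (1 / s) powr ((d - \<beta>) / 2)"
    proof (rule powr_mono2)
      show "t \<le> 1 / s" using t pi_gt3 mult_right_mono[of 1 "4 * pi" t] by (simp add: s_def)
    qed (use t beta in auto)
    also have "\<dots> = s powr (- ((d - \<beta>) / 2))"
      by (simp add: powr_divide powr_minus_divide)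
    finally have tp: "t powr ((d - \<beta>) / 2) \<le> s powr (- ((d - \<beta>) / 2))" .
    have "\<bar>heat_conv t (F P) x\<bar> \<le> A * (X * Y)"
      using heat_conv_Re_Im_chirp_le[OF a0 t less_imp_le[OF A0] P, of b v x]
        mult_left_mono[OF norm_heat_integral_chirp_le[OF a0 t s_def, of x b v] less_imp_le[OF A0]]
      by (simp add: F_def X_def Y_def D_def normv d_def)
    then have "t powr ((d - \<beta>) / 2) * \<bar>heat_conv t (F P) x\<bar> \<le> s powr (- ((d - \<beta>) / 2)) * (A * (X * Y))"
      by (intro mult_mono tp) auto
    also have "\<dots> \<le> fact m"
    proof (cases "s \<ge> K\<^sup>2")
      \<comment> \<open>Short times: the weight is at most K^(-(d - \<beta>)) = 1 / A, and both heat
        factors \<open>X\<close> and \<open>Y\<close> are at most 1.\<close>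
      case True
      have "s powr (- ((d - \<beta>) / 2)) \<le> (K\<^sup>2) powr (- ((d - \<beta>) / 2))"
        using True K0 beta by (intro powr_mono2') auto
      also have "(K\<^sup>2) powr (- ((d - \<beta>) / 2)) = K powr (2 * (- ((d - \<beta>) / 2)))"
        using K0 by (simp add: powr_powr flip: powr_numeral)
      also have "2 * (- ((d - \<beta>) / 2)) = - (d - \<beta>)" by (simp add: field_simps)
      finally have 1: "s powr (- ((d - \<beta>) / 2)) * A \<le> 1"
        using mult_right_mono[of "s powr (- ((d - \<beta>) / 2))" "K powr (- (d - \<beta>))" A] K0 A0
        by (simp add: A_def flip: powr_add)
      have 2: "X \<le> 1" unfolding X_def using D1 Ds s d by (intro powr_le1) auto
      have 3: "Y \<le> 1" unfolding Y_def using a0 s b0 by simp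
      have "(s powr (- ((d - \<beta>) / 2)) * A) * (X * Y) \<le> 1 * (1 * 1)"
        using 1 2 3 A0 by (intro mult_mono) (auto simp: X_def Y_def)
      also have "\<dots> \<le> fact m" by simp
      finally show ?thesis by (simp add: mult.assoc)
    next
      \<comment> \<open>Long times: the crude bound D \<ge> 1 suffices for \<open>X\<close>, since
        the exponential smallness of \<open>Y\<close> compensates. What is left to absorb is A
        s^(\<beta>/2) \<le> A K^\<beta> = K^d.\<close>
      case False
      have X: "X \<le> s powr (d / 2)"
      proof -
        have "s\<^sup>2 / D \<le> s\<^sup>2 / 1"
          using D1 by (intro divide_left_mono) auto
        then have "X \<le> (s\<^sup>2) powr (d / 4)"
          unfolding X_def using D1 d by (intro powr_mono2) auto
        also have "\<dots> = s powr (d / 2)"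
          using s by (simp add: powr_powr flip: powr_numeral)
        finally show ?thesis .
      qed
      have Y: "Y \<le> exp (- (K powr (2 * \<epsilon>)))"
      proof -
        \<comment> \<open>Each of a s, a^2 and b^2 is at most a K^2. The resulting constant 3 is
          below pi, and this pi cancels the one in the exponent of \<open>Y\<close>, leaving R^2 /
          K^2 = K^(2 eps).\<close>
        have "a * (s + a) + b\<^sup>2 \<le> a * (K\<^sup>2 + K\<^sup>2) + a * K\<^sup>2"
          using False aK a0 unfolding bsq by (intro add_mono mult_left_mono) auto
        also have "\<dots> = 3 * a * K\<^sup>2" by simp
        also have "\<dots> \<le> pi * a * K\<^sup>2" using pi_gt3 a0 by (intro mult_right_mono) auto
        finally have le: "a * (s + a) + b\<^sup>2 \<le> pi * a * K\<^sup>2" .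
        have R2: "R\<^sup>2 = K powr (2 * \<epsilon>) * K\<^sup>2"
        proof -
          have "R\<^sup>2 = K powr (2 * \<epsilon> + 2)" using K0 by (simp add: R_def powr_powr algebra_simps flip: powr_numeral)
          then show ?thesis using K0 by (simp add: powr_add)
        qed
        have "K powr (2 * \<epsilon>) = pi * a * R\<^sup>2 / (pi * a * K\<^sup>2)"
          using K0 a0 by (simp add: R2)
        also have "\<dots> \<le> pi * a * R\<^sup>2 / (a * (s + a) + b\<^sup>2)"
          using a0 s b0 K0 by (intro divide_left_mono le mult_pos_pos add_pos_pos) auto
        finally show ?thesis unfolding Y_def by simp
      qed
      have "s powr (- ((d - \<beta>) / 2)) * (A * (X * Y)) \<le>
            s powr (- ((d - \<beta>) / 2)) * (A * (s powr (d / 2) * exp (- (K powr (2 * \<epsilon>)))))"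
        using A0 X Y by (intro mult_left_mono mult_mono) (auto simp: Y_def)
      also have "\<dots> = A * s powr (\<beta> / 2) * exp (- (K powr (2 * \<epsilon>)))"
      proof -
        have "s powr (- ((d - \<beta>) / 2)) * s powr (d / 2) = s powr (\<beta> / 2)"
          by (simp add: field_simps flip: powr_add)
        then show ?thesis by (simp add: mult_ac)
      qed
      also have "\<dots> \<le> A * K powr \<beta> * exp (- (K powr (2 * \<epsilon>)))"
      proof -
        have "s powr (\<beta> / 2) \<le> (K\<^sup>2) powr (\<beta> / 2)"
          using False s beta by (intro powr_mono2) auto
        also have "\<dots> = K powr \<beta>"
          using K0 by (simp add: powr_powr flip: powr_numeral)
        finally show ?thesis using A0 by (intro mult_right_mono mult_left_mono) auto
      qed
      also have "A * K powr \<beta> = K powr d"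
        by (simp add: A_def flip: powr_add)
      also have "K powr d \<le> K powr (2 * \<epsilon> * real m)"
        by (rule powr_mono[OF m K])
      also have "K powr (2 * \<epsilon> * real m) = (K powr (2 * \<epsilon>)) ^ m"
        using K0 by (simp add: powr_powr flip: powr_realpow)
      also have "(K powr (2 * \<epsilon>)) ^ m \<le> fact m * exp (K powr (2 * \<epsilon>))"
        using power_div_fact_le_exp[of "K powr (2 * \<epsilon>)" m] by (simp add: field_simps)
      finally show ?thesis by (simp add: exp_minus mult.assoc)
    qed
    finally show ?thesis .
  qed
  \<comment> \<open>A lower bound, on the ball of radius K about v, for the Riesz factor times the
    modulus of the transform of the complex chirp: it uses |\<xi>| \<le> 2 R, a^2 + b^2 \<le> 2 b^2,
    and a |v - \<xi>|^2 \<le> a K^2 = b^2 for the factor exp(-pi).\<close>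
  define T where "T = (4 * pi * R) powr (- \<alpha>) * (A * ((2 * b\<^sup>2) powr (- d / 4) * exp (- pi)))"
  have T0: "T > 0" using R0 A0 b0 by (simp add: T_def)
  have T_eq: "T = (4 * pi) powr (- \<alpha>) * 2 powr (- d / 4) * exp (- pi) * K powr (- \<alpha> * (1 + \<epsilon>) - \<beta> / 2)"
  proof -
    have "(b\<^sup>2) powr (- d / 4) = K powr ((2 - \<beta> / d) * 2 * (- d / 4))"
      using b0 by (simp add: b_def powr_powr flip: powr_numeral)
    also have "(2 - \<beta> / d) * 2 * (- d / 4) = - d + \<beta> / 2" using d by (simp add: field_simps)
    finally have b: "(b\<^sup>2) powr (- d / 4) = K powr (- d + \<beta> / 2)" .
    have R: "R powr (- \<alpha>) = K powr (- \<alpha> * (1 + \<epsilon>))"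
      by (simp add: R_def powr_powr mult.commute)
    have "K powr (- \<alpha> * (1 + \<epsilon>)) * (A * K powr (- d + \<beta> / 2)) = K powr (- \<alpha> * (1 + \<epsilon>) + ((d - \<beta>) + (- d + \<beta> / 2)))"
      by (simp only: A_def powr_add)
    also have "- \<alpha> * (1 + \<epsilon>) + ((d - \<beta>) + (- d + \<beta> / 2)) = - \<alpha> * (1 + \<epsilon>) - \<beta> / 2" by simp
    finally have KK: "K powr (- \<alpha> * (1 + \<epsilon>) - \<beta> / 2) = K powr (- \<alpha> * (1 + \<epsilon>)) * (A * K powr (- d + \<beta> / 2))" ..
    show ?thesis
      unfolding T_def powr_mult[of "4 * pi" R] powr_mult[of 2 "b\<^sup>2"] b R KK by (simp only: mult_ac)
  qed
  define S where "S P = {\<xi>. T / 3 < norm (fourier_riesz \<alpha> (F P) \<xi>)}" for P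
  \<comment> \<open>The functions have to be real, so the lower bound for the complex chirp is passed on to
      one of its two parts, which may depend on K.\<close>
  have S_sets: "S P \<in> sets lborel" if P: "P = Re \<or> P = Im" for P
  proof -
    have [measurable]: "F P \<in> borel_measurable borel" using int[OF P] by auto
    show ?thesis unfolding S_def by measurable
  qed
  have "ball v K \<subseteq> S Re \<union> S Im"
  proof
    fix \<xi> assume "\<xi> \<in> ball v K"
    then have vK: "norm (v - \<xi>) < K" by (simp add: dist_norm)
    \<comment> \<open>Because |v| = R \<ge> K, the open ball omits the origin. This matters since 0
      \<open>powr\<close> (- \<alpha>) is 0, so the Riesz factor is decreasing in |\<xi>| only away
      from 0.\<close>
    have xi: "norm \<xi> \<le> 2 * R" "norm \<xi> > 0"
      using vK normv RK norm_triangle_ineq3[of v \<xi>] norm_triangle_ineq2[of v \<xi>] by linarith+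
    have "T \<le> (2 * pi * norm \<xi>) powr (- \<alpha>) * norm (A *\<^sub>R (\<integral>y. chirp a b 0 (v - \<xi>) y \<partial>lborel))"
    proof -
      have "(2 * b\<^sup>2) powr (- d / 4) \<le> (a\<^sup>2 + b\<^sup>2) powr (- d / 4)"
        using a0 b0 ab d power_mono[of a b 2] by (intro powr_mono2') (auto simp: add_pos_pos)
      moreover have "exp (- pi) \<le> exp (pi * (a * ((norm (0::'a))\<^sup>2 - (norm (v - \<xi>))\<^sup>2) - 2 * b * (0 \<bullet> (v - \<xi>))) / (a\<^sup>2 + b\<^sup>2))"
      proof -
        have "a * (norm (v - \<xi>))\<^sup>2 \<le> a * K\<^sup>2" using vK a0 by (intro mult_left_mono power_mono) auto
        also have "\<dots> \<le> a\<^sup>2 + b\<^sup>2" unfolding bsq by simp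
        finally have "a * (norm (v - \<xi>))\<^sup>2 / (a\<^sup>2 + b\<^sup>2) \<le> 1"
          using a0 by (simp add: divide_le_eq add_pos_nonneg)
        then have "pi * (a * (norm (v - \<xi>))\<^sup>2 / (a\<^sup>2 + b\<^sup>2)) \<le> pi * 1"
          by (intro mult_left_mono) auto
        then show ?thesis by simp
      qed
      ultimately have "(2 * b\<^sup>2) powr (- d / 4) * exp (- pi) \<le> norm (\<integral>y. chirp a b 0 (v - \<xi>) y \<partial>lborel)"
        unfolding norm_integral_chirp[OF a0] d_def by (intro mult_mono) auto
      moreover have "(4 * pi * R) powr (- \<alpha>) \<le> (2 * pi * norm \<xi>) powr (- \<alpha>)"
        using xi alpha R0 by (intro powr_mono2') auto
      ultimately show ?thesis
        unfolding T_def using A0 by (auto intro!: mult_mono)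
    qed
    also have "\<dots> \<le> norm (fourier_riesz \<alpha> (F Re) \<xi>) + norm (fourier_riesz \<alpha> (F Im) \<xi>)"
    proof -
      have "norm (A *\<^sub>R (\<integral>y. chirp a b 0 (v - \<xi>) y \<partial>lborel)) \<le> norm (fourier (F Re) \<xi>) + norm (fourier (F Im) \<xi>)"
        unfolding fourier_chirp[OF a0, symmetric] F_def
        by (rule norm_triangle_le) (simp add: norm_mult)
      then have "(2 * pi * norm \<xi>) powr (- \<alpha>) * norm (A *\<^sub>R (\<integral>y. chirp a b 0 (v - \<xi>) y \<partial>lborel)) \<le>
         (2 * pi * norm \<xi>) powr (- \<alpha>) * (norm (fourier (F Re) \<xi>) + norm (fourier (F Im) \<xi>))"
        by (intro mult_left_mono) auto
      then show ?thesis by (simp add: fourier_riesz_def norm_mult distrib_left)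
    qed
    \<comment> \<open>If neither part exceeded T / 3, the sum would be at most 2 T / 3 < T. The
      level T / 2 would not contradict the non-strict bound.\<close>
    finally show "\<xi> \<in> S Re \<union> S Im" using T0 by (auto simp: S_def)
  qed
  then have "ennreal (unit_ball_vol d * K ^ DIM('a) / 2) \<le> emeasure lborel (S Re) \<or>
             ennreal (unit_ball_vol d * K ^ DIM('a) / 2) \<le> emeasure lborel (S Im)"
    using K0 d by (intro emeasure_Un_half[of _ _ _ "ball v K"] S_sets)
      (auto simp: d_def intro!: emeasure_ball)
  then obtain P where P: "P = Re \<or> P = Im" and
    S: "ennreal (unit_ball_vol d * K ^ DIM('a) / 2) \<le> emeasure lborel (S P)" by blast
  have vol: "unit_ball_vol d \<ge> 0" using d by simp
  have "ennreal (T / 3 * (unit_ball_vol d * K ^ DIM('a) / 2) powr (1 / r)) \<le> weak_Lr_norm r (fourier_riesz \<alpha> (F P))"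
    by (rule weak_Lr_norm_ge) (use T0 r S vol K0 in \<open>auto simp: S_def\<close>)
  also have "T / 3 * (unit_ball_vol d * K ^ DIM('a) / 2) powr (1 / r) =
     (4 * pi) powr (- \<alpha>) * 2 powr (- d / 4) * exp (- pi) / 3 * (unit_ball_vol d / 2) powr (1 / r) *
       K powr (d / r - \<alpha> * (1 + \<epsilon>) - \<beta> / 2)"
  proof -
    have "(unit_ball_vol d * K ^ DIM('a) / 2) powr (1 / r) = (unit_ball_vol d / 2 * K powr d) powr (1 / r)"
      using K0 by (simp add: d_def powr_realpow)
    also have "\<dots> = (unit_ball_vol d / 2) powr (1 / r) * K powr (d / r)"
      by (simp only: powr_mult powr_powr) simp
    finally have 1: "(unit_ball_vol d * K ^ DIM('a) / 2) powr (1 / r) = (unit_ball_vol d / 2) powr (1 / r) * K powr (d / r)" .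
    have "d / r - \<alpha> * (1 + \<epsilon>) - \<beta> / 2 = (- \<alpha> * (1 + \<epsilon>) - \<beta> / 2) + d / r" by simp
    then have 2: "K powr (d / r - \<alpha> * (1 + \<epsilon>) - \<beta> / 2) = K powr (- \<alpha> * (1 + \<epsilon>) - \<beta> / 2) * K powr (d / r)"
      by (simp only: powr_add)
    show ?thesis unfolding 1 2 T_eq by (simp only: mult_ac times_divide_eq_left times_divide_eq_right)
  qed
  finally show ?thesis
    using int[OF P] L1[OF P] heat[OF P] by blast
qed

section \<open>Choice of the exponents and passage to the limit\<close>

theorem theorem1p6:
  fixes \<beta> \<alpha> r :: real
  assumes "0 < \<beta>" "\<beta> \<le> real DIM('a::euclidean_space)"
    and "0 < \<alpha>" "\<alpha> < real DIM('a)"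
    and "(real DIM('a) - \<beta>) / 2 < \<alpha>" "\<alpha> < real DIM('a) - \<beta> / 2"
    and "0 < r" "r < 2 * real DIM('a) / (2 * \<alpha> + \<beta>)"
  shows "\<exists>(\<Phi> :: nat \<Rightarrow> 'a \<Rightarrow> real) C.
           (\<forall>N. integrable lborel (\<Phi> N)) \<and>
           (\<forall>N. (\<integral>x. \<bar>\<Phi> N x\<bar> \<partial>lborel) \<le> C) \<and>
           (\<forall>N. \<forall>t>0. AE x in lborel.
               t powr ((real DIM('a) - \<beta>) / 2) * \<bar>heat_conv t (\<Phi> N) x\<bar> \<le> C) \<and>
           ((\<lambda>N. weak_Lr_norm r (fourier_riesz \<alpha> (\<Phi> N))) \<longlonglongrightarrow> \<infinity>)"
proof -
  define d where "d = real DIM('a)"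
  \<comment> \<open>The bound on r says exactly that d / r - \<alpha> - \<beta> / 2 is positive.
    Half of this gap is spent on \<alpha> \<epsilon> = \<delta>, and the other half remains as the
    exponent of K in the lower bound.\<close>
  define \<delta> where "\<delta> = (d / r - \<alpha> - \<beta> / 2) / 2"
  define \<epsilon> where "\<epsilon> = \<delta> / \<alpha>"
  \<comment> \<open>\<open>m\<close> depends only on the fixed parameters, so m! is a bound uniform
    in N.\<close>
  define m where "m = nat \<lceil>d / (2 * \<epsilon>)\<rceil>"
  define c where "c = (4 * pi) powr (- \<alpha>) * 2 powr (- d / 4) * exp (- pi) / 3 * (unit_ball_vol d / 2) powr (1 / r)"
  have d: "d > 0" by (simp add: d_def)
  have "\<delta> > 0"
    using assms by (simp add: \<delta>_def d_def field_simps)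
  then have eps: "\<epsilon> > 0" using assms by (simp add: \<epsilon>_def)
  have m: "d \<le> 2 * \<epsilon> * real m"
  proof -
    have "d / (2 * \<epsilon>) \<le> real m" unfolding m_def by linarith
    then show ?thesis using eps by (simp add: field_simps)
  qed
  have expo: "d / r - \<alpha> * (1 + \<epsilon>) - \<beta> / 2 = \<delta>"
    using assms by (simp add: \<epsilon>_def \<delta>_def field_simps)
  have "unit_ball_vol d / 2 > 0" using d by simp
  then have "c > 0" unfolding c_def by (intro mult_pos_pos divide_pos_pos) auto
  \<comment> \<open>The scale is K = N + 1, which satisfies K \<ge> 1 already for N = 0.\<close>
  have "\<forall>N::nat. \<exists>\<Phi> :: 'a \<Rightarrow> real. integrable lborel \<Phi> \<and> (\<integral>x. \<bar>\<Phi> x\<bar> \<partial>lborel) \<le> 1 \<and>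
     (\<forall>t>0. \<forall>x. t powr ((d - \<beta>) / 2) * \<bar>heat_conv t \<Phi> x\<bar> \<le> fact m) \<and>
     ennreal (c * real (Suc N) powr \<delta>) \<le> weak_Lr_norm r (fourier_riesz \<alpha> \<Phi>)"
    using chirp_family[where 'a='a, of \<beta> \<alpha> r \<epsilon> m, folded d_def] assms eps m
    unfolding c_def expo by (simp add: d_def)
  then obtain \<Phi> :: "nat \<Rightarrow> 'a \<Rightarrow> real" where
    \<Phi>: "integrable lborel (\<Phi> N)" "(\<integral>x. \<bar>\<Phi> N x\<bar> \<partial>lborel) \<le> 1"
     "\<forall>t>0. \<forall>x. t powr ((d - \<beta>) / 2) * \<bar>heat_conv t (\<Phi> N) x\<bar> \<le> fact m"
     "ennreal (c * real (Suc N) powr \<delta>) \<le> weak_Lr_norm r (fourier_riesz \<alpha> (\<Phi> N))" for N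
    by metis
  have "filterlim (\<lambda>N. c * real (Suc N) powr \<delta>) at_top sequentially"
    using \<open>c > 0\<close> \<open>\<delta> > 0\<close> by real_asymp
  then have "(\<lambda>N. ennreal (c * real (Suc N) powr \<delta>)) \<longlonglongrightarrow> top"
    by (simp only: ennreal_tendsto_top_eq_at_top)
  then have "(\<lambda>N. weak_Lr_norm r (fourier_riesz \<alpha> (\<Phi> N))) \<longlonglongrightarrow> top"
    by (rule tendsto_sandwich[OF _ _ _ tendsto_const, rotated 2]) (auto simp del: of_nat_Suc intro!: always_eventually \<Phi>)
  \<comment> \<open>One constant C must serve for both norms; m! \<ge> 1 allows C = m!.\<close>
  moreover have "(\<integral>x. \<bar>\<Phi> N x\<bar> \<partial>lborel) \<le> fact m" for N
    using \<Phi>(2)[of N] fact_ge_1[of m, where 'a=real] by linarith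
  ultimately show ?thesis
    using \<Phi> by (intro exI[of _ \<Phi>] exI[of _ "fact m"]) (auto simp: d_def)
qed

end
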